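(* For $(A,B,C,D)=(0,0,0,0)$ and for $(A,B,C,D)=(2,1,2,-1)$, the series $\tan_q(z)=\tan_q^{(A,B,C,D)}(z)$ has the continued fraction expansion $$\tan_q(z)=\cfrac{z}{[1]_qq^{-0}-\cfrac{z^2}{[3]_qq^{-1}-\cfrac{z^2}{[5]_qq^{-2}-\cfrac{z^2}{[7]_qq^{-3}-\cfrac{z^2}{\ddots}}}}}$$ where the $k$-th partial denominator ($k\ge1$) is $[2k-1]_q\,q^{-(k-1)}$. In particular, the two tangent functions $\tan_q^{(0,0,0,0)}(z)$ and $\tan_q^{(2,1,2,-1)}(z)$ coincide.
   Context: Let $0<q<1$, $[n]_q=\frac{1-q^n}{1-q}$, $[n]_q!=[1]_q[2]_q\cdots[n]_q$, $[0]_q!=1$. For a vector of exponents $(A,B,C,D)$ define the power series in $z$ $$\sin_q(z)=\sum_{n\ge0}\frac{(-1)^nz^{2n+1}}{[2n+1]_q!}q^{An^2+Bn},\qquad \cos_q(z)=\sum_{n\ge0}\frac{(-1)^nz^{2n}}{[2n]_q!}q^{Cn^2+Dn},$$ and $\tan_q^{(A,B,C,D)}(z)=\sin_q(z)/\cos_q(z)$. The continued fraction is understood as an identity of formal power series in $z$: the finite truncations (convergents), which are rational functions of $z$ expanded at $z=0$, converge coefficientwise to $\tan_q(z)$. *)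

theory Defs
  imports Complex_Main "HOL-Computational_Algebra.Formal_Power_Series"
begin

definition qnum :: "real \<Rightarrow> nat \<Rightarrow> real" where
  "qnum q n = (1 - q ^ n) / (1 - q)"

definition qfact :: "real \<Rightarrow> nat \<Rightarrow> real" where
  "qfact q n = (\<Prod>k = 1..n. qnum q k)"

definition sin_q :: "int \<Rightarrow> int \<Rightarrow> real \<Rightarrow> real fps" where
  "sin_q A B q = Abs_fps (\<lambda>m. if odd m
     then (let n = m div 2
           in (-1) ^ n / qfact q (2 * n + 1) * q powi (A * int n ^ 2 + B * int n))
     else 0)"

definition cos_q :: "int \<Rightarrow> int \<Rightarrow> real \<Rightarrow> real fps" where
  "cos_q C D q = Abs_fps (\<lambda>m. if even m
     then (let n = m div 2
           in (-1) ^ n / qfact q (2 * n) * q powi (C * int n ^ 2 + D * int n))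
     else 0)"

text \<open>
  The quotient is a genuine one, since \<open>cos_q\<close> has constant coefficient 1 and is
  therefore a unit in the ring of formal power series.
\<close>

definition tan_q :: "int \<Rightarrow> int \<Rightarrow> int \<Rightarrow> int \<Rightarrow> real \<Rightarrow> real fps" where
  "tan_q A B C D q = sin_q A B q / cos_q C D q"

text \<open>
  \<open>cfrac_trunc a b k N\<close> is the finite continued fraction
  \<open>a k / (b k - a (k+1) / (b (k+1) - ... - a (k+N-1) / b (k+N-1)))\<close> with \<open>N\<close> levels.
  When all \<open>b j\<close> have nonzero constant coefficient and all \<open>a j\<close> have zero constant
  coefficient, every denominator is a unit, so that division of formal power series yields
  the expansion at 0 of the corresponding rational function.
\<close>

primrec cfrac_trunc ::
    "(nat \<Rightarrow> real fps) \<Rightarrow> (nat \<Rightarrow> real fps) \<Rightarrow> nat \<Rightarrow> nat \<Rightarrow> real fps" where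
  "cfrac_trunc a b k 0 = 0"
| "cfrac_trunc a b k (Suc N) = a k / (b k - cfrac_trunc a b (Suc k) N)"

text \<open>
  Convergence is taken in the library's metric on formal power series, i.e. every
  coefficient of the convergents is eventually equal to that of the limit; in particular
  it implies convergence of each coefficient sequence in the reals.
\<close>

definition has_cfrac ::
    "real fps \<Rightarrow> (nat \<Rightarrow> real fps) \<Rightarrow> (nat \<Rightarrow> real fps) \<Rightarrow> bool" where
  "has_cfrac f a b \<longleftrightarrow> (\<lambda>N. cfrac_trunc a b 1 N) \<longlonglongrightarrow> f"

definition tan_q_num :: "nat \<Rightarrow> real fps" where
  "tan_q_num k = (if k = 1 then fps_X else fps_X ^ 2)"

definition tan_q_denom :: "real \<Rightarrow> nat \<Rightarrow> real fps" where
  "tan_q_denom q k = fps_const (qnum q (2 * k - 1) * q powi (- (int k - 1)))"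

end

theory Submission
  imports Defs
begin

unbundle fps_syntax

text \<open>
  Put \<open>T\<^sub>0 = cos\<^sub>q\<close>, \<open>z T\<^sub>1 = sin\<^sub>q\<close> and \<open>z\<^sup>2 T\<^sub>k\<^sub>+\<^sub>1 = b\<^sub>k T\<^sub>k - T\<^sub>k\<^sub>-\<^sub>1\<close>, where \<open>b\<^sub>k\<close> is the \<open>k\<close>-th
  partial denominator. In both cases this recurrence has the explicit solution
  \[ T_k = \sum_n (-1)^n \frac{q^{k(k-1)/2 + c(2n^2+(2k-1)n)}}{[2n]_q!\,[2n+1]_q [2n+3]_q \cdots [2n+2k-1]_q} z^{2n}, \]
  with \<open>c = 0\<close> for the exponents \<open>(0,0,0,0)\<close> and \<open>c = 1\<close> for \<open>(2,1,2,-1)\<close>; its constant terms do not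
  vanish. Hence \<open>z\<^sup>2 T\<^sub>k / T\<^sub>k\<^sub>-\<^sub>1\<close> is the \<open>k\<close>-th tail of the continued fraction (with \<open>z\<close> in place of
  \<open>z\<^sup>2\<close> if \<open>k = 1\<close>), and since \<open>z\<close> divides every partial numerator, the truncation error gains
  a factor \<open>z\<close> with each level. The two tangents agree because limits are unique.
\<close>

section \<open>Convergence of a continued fraction whose exact tails are known\<close>

lemma fps_tendsto_of_power_dvd:
  fixes f :: "'a::comm_ring_1 fps"
  assumes "\<And>N. fps_X ^ N dvd t N - f"
  shows "t \<longlonglongrightarrow> f"
proof (rule tendsto_fpsI)
  fix n
  have "t N $ n = f $ n" if "N > n" for N
  proof -
    obtain c where "t N - f = fps_X ^ N * c" using assms[of N] by (elim dvdE)
    then have "(t N - f) $ n = 0" using that by (simp add: fps_X_power_mult_nth)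
    then show ?thesis by simp
  qed
  then show "\<forall>\<^sub>F N in sequentially. t N $ n = f $ n"
    using eventually_sequentiallyI[of "Suc n"] by (metis (mono_tags, lifting) Suc_le_lessD)
qed

lemma fps_X_dvd_iff: "fps_X dvd f \<longleftrightarrow> f $ 0 = (0 :: 'a :: field)"
  by (cases "f = 0") (simp_all add: fps_dvd_iff Suc_le_eq subdegree_eq_0_iff flip: neq0_conv)

lemma cfrac_trunc_nth_0:
  assumes "\<And>k. a (Suc k) $ 0 = 0" "\<And>k. b (Suc k) $ 0 \<noteq> 0"
  shows "cfrac_trunc a b (Suc k) N $ 0 = 0"
proof (induction N arbitrary: k)
  case (Suc N)
  then show ?case using assms by (simp add: fps_divide_unit)
qed simp

text \<open>Here \<open>f\<close> lists the exact tails. For a truncated tail \<open>t\<close> one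
  has a/(b-t) - a/(b-f) = a(t-f)/((b-t)(b-f)), where the denominator is a unit and \<open>a\<close>
  is divisible by \<open>fps_X\<close>, so each level adds one factor \<open>fps_X\<close> to the
  error.\<close>

lemma cfrac_trunc_error:
  assumes a: "\<And>k. a (Suc k) $ 0 = 0" and b: "\<And>k. b (Suc k) $ 0 \<noteq> 0"
    and f: "\<And>k. f (Suc k) $ 0 = 0"
    and rec: "\<And>k. f (Suc k) * (b (Suc k) - f (Suc (Suc k))) = a (Suc k)"
  shows "fps_X ^ N dvd cfrac_trunc a b (Suc k) N - f (Suc k)"
proof (induction N arbitrary: k)
  case (Suc N)
  let ?t = "cfrac_trunc a b (Suc (Suc k)) N" and ?b = "b (Suc k)"
  let ?f = "f (Suc (Suc k))"
  have u: "(?b - ?t) $ 0 \<noteq> 0" "(?b - ?f) $ 0 \<noteq> 0"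
    using b f cfrac_trunc_nth_0[of a b, OF a b] by simp_all
  then have u1: "is_unit ((?b - ?t) * (?b - ?f))" by (simp add: fps_is_unit_iff)
  have t: "cfrac_trunc a b (Suc k) (Suc N) * (?b - ?t) = a (Suc k)"
    using u(1) by (simp add: fps_divide_unit mult.assoc inverse_mult_eq_1)
  have "(cfrac_trunc a b (Suc k) (Suc N) - f (Suc k)) * ((?b - ?t) * (?b - ?f))
      = cfrac_trunc a b (Suc k) (Suc N) * (?b - ?t) * (?b - ?f)
        - f (Suc k) * (?b - ?f) * (?b - ?t)"
    by (simp only: left_diff_distrib mult_ac)
  also have "\<dots> = a (Suc k) * (?b - ?f) - a (Suc k) * (?b - ?t)"
    by (simp only: t rec)
  also have "\<dots> = a (Suc k) * (?t - ?f)" by (simp add: algebra_simps)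
  finally have e: "(cfrac_trunc a b (Suc k) (Suc N) - f (Suc k)) * ((?b - ?t) * (?b - ?f))
      = a (Suc k) * (?t - ?f)" .
  have "fps_X dvd a (Suc k)" using a by (simp add: fps_X_dvd_iff)
  with Suc have "fps_X ^ Suc N dvd a (Suc k) * (?t - ?f)"
    by (simp only: power_Suc mult_dvd_mono)
  then show ?case unfolding e[symmetric] using dvd_mult_unit_iff[OF u1] by blast
qed simp

lemma has_cfracI:
  assumes "\<And>k. a (Suc k) $ 0 = 0" "\<And>k. b (Suc k) $ 0 \<noteq> 0" "\<And>k. f (Suc k) $ 0 = 0"
    and "\<And>k. f (Suc k) * (b (Suc k) - f (Suc (Suc k))) = a (Suc k)"
  shows "has_cfrac (f 1) a b"
  unfolding has_cfrac_def One_nat_def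
  using cfrac_trunc_error[of a b f, OF assms] by (rule fps_tendsto_of_power_dvd)

section \<open>q-numbers and the three-term recurrence of the tail series\<close>

lemma qnum_add: "qnum q (m + n) = qnum q m + q ^ m * qnum q n"
  by (simp add: qnum_def power_add right_diff_distrib flip: add_divide_distrib)

lemma qnum_pos: "0 < q \<Longrightarrow> q < 1 \<Longrightarrow> 0 < n \<Longrightarrow> qnum q n > 0"
  by (simp add: qnum_def power_less_one_iff)

lemma qfact_Suc: "qfact q (Suc n) = qfact q n * qnum q (Suc n)"
  by (simp add: qfact_def)

lemma qfact_pos: "0 < q \<Longrightarrow> q < 1 \<Longrightarrow> qfact q n > 0"
  by (auto simp: qfact_def intro!: prod_pos qnum_pos)

text \<open>For k = 0 and k = 1 this is [2n]! and [2n+1]!, the denominators of cosine and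
  sine.\<close>

definition tail_den :: "real \<Rightarrow> nat \<Rightarrow> nat \<Rightarrow> real" where
  "tail_den q k n = qfact q (2 * n) * (\<Prod>j<k. qnum q (2 * n + 2 * j + 1))"

text \<open>The powers of q are left abstract in \<open>u\<close>, so that both exponent vectors
  share one recurrence proof.\<close>

definition tail_fps :: "(nat \<Rightarrow> nat \<Rightarrow> real) \<Rightarrow> real \<Rightarrow> nat \<Rightarrow> real fps" where
  "tail_fps u q k = Abs_fps (\<lambda>m. if even m
     then (-1) ^ (m div 2) * u k (m div 2) / tail_den q k (m div 2) else 0)"

lemma tail_den_pos: "0 < q \<Longrightarrow> q < 1 \<Longrightarrow> tail_den q k n > 0"
  by (auto simp: tail_den_def intro!: mult_pos_pos prod_pos qfact_pos qnum_pos)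

lemma tail_den_Suc_left:
  "tail_den q (Suc k) n = tail_den q k n * qnum q (2 * n + 2 * k + 1)"
  by (simp add: tail_den_def)

text \<open>The factor j = 0 and the extra q-number complete [2n]! to [2n+2]!; the other factors are
  those of \<open>Suc n\<close> with j shifted by one.\<close>

lemma tail_den_Suc_right:
  "tail_den q (Suc k) n * qnum q (2 * n + 2) = tail_den q k (Suc n)"
proof -
  have "tail_den q (Suc k) n =
      qfact q (2 * n) * qnum q (2 * n + 1) * (\<Prod>j<k. qnum q (2 * Suc n + 2 * j + 1))"
    unfolding tail_den_def by (subst prod.lessThan_Suc_shift) (simp add: mult.assoc)
  moreover have "qfact q (2 * Suc n) = qfact q (2 * n) * qnum q (2 * n + 1) * qnum q (2 * n + 2)"
    by (simp add: qfact_Suc)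
  ultimately show ?thesis by (simp only: tail_den_def mult_ac)
qed

text \<open>The assumption \<open>u0\<close> is the comparison of constant terms, and
  \<open>uS\<close> that of the coefficients of z^(2n+2) after clearing denominators.\<close>

lemma tail_fps_rec:
  assumes q: "0 < q" "q < 1"
    and u0: "\<And>k. u k 0 = q powi (- int k) * u (Suc k) 0"
    and uS: "\<And>k n. u k (Suc n) * qnum q (2 * n + 2 * k + 3)
      - qnum q (2 * k + 1) * q powi (- int k) * u (Suc k) (Suc n)
      = qnum q (2 * n + 2) * u (Suc (Suc k)) n"
  shows "fps_X ^ 2 * tail_fps u q (Suc (Suc k))
    = tan_q_denom q (Suc k) * tail_fps u q (Suc k) - tail_fps u q k"
proof (rule fps_ext)
  fix m
  have b: "tan_q_denom q (Suc k) = fps_const (qnum q (2 * k + 1) * q powi (- int k))"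
    by (simp add: tan_q_denom_def)
  show "(fps_X ^ 2 * tail_fps u q (Suc (Suc k))) $ m
    = (tan_q_denom q (Suc k) * tail_fps u q (Suc k) - tail_fps u q k) $ m"
  proof (cases "even m")
    case False
    then show ?thesis by (simp add: b tail_fps_def fps_X_power_mult_nth)
  next
    case True
    then obtain n where m: "m = 2 * n" by (elim evenE)
    show ?thesis
    proof (cases n)
      case 0
      have "qnum q (2 * k + 1) > 0" "tail_den q k 0 > 0"
        using q by (simp_all add: qnum_pos tail_den_pos)
      then show ?thesis
        by (simp add: b m 0 tail_fps_def fps_X_power_mult_nth tail_den_Suc_left u0[of k] field_simps)
    next
      case (Suc n')
      define D where "D = tail_den q (Suc (Suc k)) n'"
      define E where "E = tail_den q k (Suc n')"
      define A where "A = qnum q (2 * n' + 2 * k + 3)"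
      define B where "B = qnum q (2 * n' + 2)"
      have E1: "tail_den q (Suc k) (Suc n') = E * A"
        unfolding E_def A_def by (simp add: tail_den_Suc_left eval_nat_numeral)
      \<comment> \<open>Both products equal the denominator in T_(k+1) at index n'+1, which thus
        serves as common denominator of all three terms.\<close>
      have E2: "E * A = D * B"
        unfolding E1[symmetric] D_def B_def by (simp only: tail_den_Suc_right)
      have pos: "A \<noteq> 0" "B \<noteq> 0" "D \<noteq> 0" "E \<noteq> 0"
        using q by (simp_all add: A_def B_def D_def E_def qnum_pos tail_den_pos less_imp_neq[symmetric])
      let ?c = "qnum q (2 * k + 1) * q powi (- int k)"
      have "u (Suc (Suc k)) n' / D = B * u (Suc (Suc k)) n' / (E * A)"
        using pos by (simp add: E2)
      also have "\<dots> = (u k (Suc n') * A - ?c * u (Suc k) (Suc n')) / (E * A)"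
        using uS[of k n'] by (simp add: A_def B_def)
      also have "\<dots> = u k (Suc n') / E - ?c * (u (Suc k) (Suc n') / (E * A))"
        using pos by (simp add: diff_divide_distrib)
      finally have key: "u (Suc (Suc k)) n' / D =
        u k (Suc n') / E - ?c * (u (Suc k) (Suc n') / (E * A))" .
      have "(fps_X ^ 2 * tail_fps u q (Suc (Suc k))) $ m = (-1) ^ n' * (u (Suc (Suc k)) n' / D)"
        by (simp add: m Suc tail_fps_def fps_X_power_mult_nth D_def)
      moreover have "(tan_q_denom q (Suc k) * tail_fps u q (Suc k) - tail_fps u q k) $ m
        = (-1) ^ n' * (u k (Suc n') / E - ?c * (u (Suc k) (Suc n') / (E * A)))"
        by (simp add: b m Suc tail_fps_def E1 E_def[symmetric] algebra_simps)
      ultimately show ?thesis using key by simp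
    qed
  qed
qed

lemma has_cfrac_tail_fps:
  assumes q: "0 < q" "q < 1"
    and nz: "\<And>k. u k 0 \<noteq> 0"
    and u0: "\<And>k. u k 0 = q powi (- int k) * u (Suc k) 0"
    and uS: "\<And>k n. u k (Suc n) * qnum q (2 * n + 2 * k + 3)
      - qnum q (2 * k + 1) * q powi (- int k) * u (Suc k) (Suc n)
      = qnum q (2 * n + 2) * u (Suc (Suc k)) n"
  shows "has_cfrac (fps_X * tail_fps u q 1 / tail_fps u q 0) tan_q_num (tan_q_denom q)"
proof -
  let ?T = "tail_fps u q"
  \<comment> \<open>These are the exact tails; \<open>f 1\<close> is the tangent. Only indices k >=
    1 matter, so k - 1 is never truncated.\<close>
  define f where "f k = tan_q_num k * ?T k / ?T (k - 1)" for k
  have T0: "?T k $ 0 \<noteq> 0" for k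
    using nz tail_den_pos[OF q, of k 0] by (simp add: tail_fps_def)
  have a0: "tan_q_num (Suc k) $ 0 = 0" for k by (simp add: tan_q_num_def)
  have fT: "f (Suc k) * ?T k = tan_q_num (Suc k) * ?T (Suc k)" for k
    using T0 by (simp add: f_def fps_divide_unit mult.assoc inverse_mult_eq_1)
  have "has_cfrac (f 1) tan_q_num (tan_q_denom q)"
  proof (rule has_cfracI)
    fix k
    show "tan_q_num (Suc k) $ 0 = 0" by (rule a0)
    show "tan_q_denom q (Suc k) $ 0 \<noteq> 0"
      using q qnum_pos[OF q, of "2 * k + 1"] by (simp add: tan_q_denom_def)
    show "f (Suc k) $ 0 = 0"
      using T0 a0 by (simp add: f_def fps_divide_unit)
    let ?g = "tan_q_denom q (Suc k) - f (Suc (Suc k))"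
    have "?g * ?T (Suc k) = tan_q_denom q (Suc k) * ?T (Suc k) - fps_X ^ 2 * ?T (Suc (Suc k))"
      using fT[of "Suc k"] by (simp add: left_diff_distrib tan_q_num_def)
    also have "\<dots> = ?T k" using tail_fps_rec[of q u, OF q u0 uS] by simp
    finally have "f (Suc k) * ?g * ?T (Suc k) = tan_q_num (Suc k) * ?T (Suc k)"
      using fT[of k] by (simp only: mult.assoc)
    \<comment> \<open>Power series over a field form an integral domain, so this factor
      cancels.\<close>
    moreover have "?T (Suc k) \<noteq> 0" using T0[of "Suc k"] by auto
    ultimately show "f (Suc k) * ?g = tan_q_num (Suc k)" by simp
  qed
  then show ?thesis by (simp add: f_def tan_q_num_def)
qed

section \<open>The two exponent vectors\<close>

lemma choose_two_Suc: "Suc k choose 2 = k + (k choose 2)"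
  by (simp add: numeral_2_eq_2)

lemma powi_shift:
  assumes "q \<noteq> (0 :: 'a :: field)" shows "q powi (- int k) * (q ^ k * x) = x"
  using assms by (simp add: power_int_minus field_simps)

lemma powi_add_of_nat:
  assumes "q > (0 :: real)" shows "q powi (a + int m) = q ^ m * q powi a"
  using assms by (simp add: power_int_add)

lemma tan_q_0_cfrac:
  assumes q: "0 < q" "q < 1"
  shows "has_cfrac (tan_q 0 0 0 0 q) tan_q_num (tan_q_denom q)"
proof -
  define u where "u k (n :: nat) = q ^ (k choose 2)" for k n
  have "has_cfrac (fps_X * tail_fps u q 1 / tail_fps u q 0) tan_q_num (tan_q_denom q)"
  proof (rule has_cfrac_tail_fps[OF q])
    fix k n
    show "u k 0 \<noteq> 0" using q by (simp add: u_def)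
    show "u k 0 = q powi (- int k) * u (Suc k) 0"
      using q by (simp add: u_def choose_two_Suc power_add powi_shift)
    \<comment> \<open>Splitting off [2k+1] first produces the weight q^(2k+1), which is exactly the
      ratio of \<open>u (Suc (Suc k)) n\<close> to \<open>u k (Suc n)\<close>.\<close>
    have "qnum q (2 * n + 2 * k + 3) = qnum q (2 * k + 1) + q ^ (2 * k + 1) * qnum q (2 * n + 2)"
      using qnum_add[of q "2 * k + 1" "2 * n + 2"] by (simp add: algebra_simps eval_nat_numeral)
    moreover have "q powi (- int k) * u (Suc k) (Suc n) = q ^ (k choose 2)"
      using q by (simp add: u_def choose_two_Suc power_add powi_shift)
    moreover have "u (Suc (Suc k)) n = q ^ (2 * k + 1) * q ^ (k choose 2)"
      by (simp add: u_def choose_two_Suc power_add mult_2)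
    ultimately show "u k (Suc n) * qnum q (2 * n + 2 * k + 3)
      - qnum q (2 * k + 1) * q powi (- int k) * u (Suc k) (Suc n)
      = qnum q (2 * n + 2) * u (Suc (Suc k)) n"
      by (simp add: u_def mult.assoc) (simp add: algebra_simps)
  qed
  moreover have "fps_X * tail_fps u q 1 = sin_q 0 0 q"
    by (rule fps_ext) (auto simp: sin_q_def tail_fps_def tail_den_def u_def qfact_Suc
      binomial_eq_0 elim!: oddE)
  moreover have "tail_fps u q 0 = cos_q 0 0 q"
    by (rule fps_ext) (auto simp: cos_q_def tail_fps_def tail_den_def u_def binomial_eq_0)
  ultimately show ?thesis by (simp add: tan_q_def)
qed

lemma tan_q_2_cfrac:
  assumes q: "0 < q" "q < 1"
  shows "has_cfrac (tan_q 2 1 2 (-1) q) tan_q_num (tan_q_denom q)"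
proof -
  \<comment> \<open>At k = 0 and k = 1 this is 2n^2 - n and 2n^2 + n, the exponents of cosine and
    sine. Integers are needed for 2k - 1 at k = 0.\<close>
  define e where "e k n = 2 * int n ^ 2 + (2 * int k - 1) * int n" for k n
  define u where "u k n = q ^ (k choose 2) * q powi e k n" for k n
  have "has_cfrac (fps_X * tail_fps u q 1 / tail_fps u q 0) tan_q_num (tan_q_denom q)"
  proof (rule has_cfrac_tail_fps[OF q])
    fix k n
    show "u k 0 \<noteq> 0" using q by (simp add: u_def)
    show "u k 0 = q powi (- int k) * u (Suc k) 0"
      using q by (simp add: u_def e_def choose_two_Suc power_add powi_shift)
    \<comment> \<open>Here [2n+2] is split off first: the weight q^(2n+2) now comes from the middle
      term, while \<open>u (Suc (Suc k)) n\<close> and \<open>u k (Suc n)\<close> agree.\<close>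
    have qn: "qnum q (2 * n + 2 * k + 3) = qnum q (2 * n + 2) + q ^ (2 * n + 2) * qnum q (2 * k + 1)"
      using qnum_add[of q "2 * n + 2" "2 * k + 1"] by (simp add: algebra_simps eval_nat_numeral)
    have "e (Suc k) (Suc n) = e k (Suc n) + int (2 * n + 2)"
      by (simp add: e_def algebra_simps)
    then have "q powi e (Suc k) (Suc n) = q ^ (2 * n + 2) * q powi e k (Suc n)"
      using q by (simp only: powi_add_of_nat)
    then have 1: "q powi (- int k) * u (Suc k) (Suc n) = q ^ (2 * n + 2) * u k (Suc n)"
      using q by (simp add: u_def choose_two_Suc power_add powi_shift)
    have "e k (Suc n) = e (Suc (Suc k)) n + int (2 * k + 1)"
      by (simp add: e_def algebra_simps power2_eq_square)
    then have "q powi e k (Suc n) = q ^ (2 * k + 1) * q powi e (Suc (Suc k)) n"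
      using q by (simp only: powi_add_of_nat)
    then have 2: "u (Suc (Suc k)) n = u k (Suc n)"
      by (simp add: u_def choose_two_Suc power_add mult_2)
    show "u k (Suc n) * qnum q (2 * n + 2 * k + 3)
      - qnum q (2 * k + 1) * q powi (- int k) * u (Suc k) (Suc n)
      = qnum q (2 * n + 2) * u (Suc (Suc k)) n"
      unfolding mult.assoc 1 2 qn by (simp add: algebra_simps)
  qed
  moreover have "fps_X * tail_fps u q 1 = sin_q 2 1 q"
    by (rule fps_ext) (auto simp: sin_q_def tail_fps_def tail_den_def u_def e_def qfact_Suc
      binomial_eq_0 elim!: oddE)
  moreover have "tail_fps u q 0 = cos_q 2 (-1) q"
    by (rule fps_ext) (auto simp: cos_q_def tail_fps_def tail_den_def u_def e_def
      binomial_eq_0)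
  ultimately show ?thesis by (simp add: tan_q_def)
qed

theorem theorem7:
  fixes q :: real
  assumes "0 < q" and "q < 1"
  shows "has_cfrac (tan_q 0 0 0 0 q) tan_q_num (tan_q_denom q) \<and>
         has_cfrac (tan_q 2 1 2 (-1) q) tan_q_num (tan_q_denom q) \<and>
         tan_q 0 0 0 0 q = tan_q 2 1 2 (-1) q"
  using tan_q_0_cfrac[OF assms] tan_q_2_cfrac[OF assms]
  unfolding has_cfrac_def by (blast intro: LIMSEQ_unique)

end
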